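(* Let $n\ge 1$ be an integer, let $N\in\mathbb{R}$ with $2N+n>2$, and let $a,b,s>0$, $r\ge 0$. Let $\mathbf{X}\sim GL_n(\bm\mu,\mathbf\Sigma,g_n)$, where $\bm\mu\in\mathbb{R}^n$, $\mathbf\Sigma$ is an $n\times n$ positive definite matrix, and $$g_n(t)=\frac{t^{N-1}\exp(-at^{s})}{(1+\exp(-bt^{s}))^{2r}},\quad t>0,$$ that is, $\mathbf{X}$ has density $f(\mathbf{x})=C_n|\mathbf\Sigma|^{-1/2}g_n\big((\mathbf{x}-\bm\mu)^T\mathbf\Sigma^{-1}(\mathbf{x}-\bm\mu)\big)$ on $\mathbb{R}^n$. Then the normalizing constant is $$C_n=c_n^*(N,b,s)\left[\Phi_{2r}^*\Big(-1,\tfrac1s\big(N+\tfrac n2-1\big),\tfrac ab\Big)\right]^{-1},$$ where $$c_n^*(N,b,s)=\frac{\Gamma(\frac n2)}{\Gamma\big(\frac1s(N+\frac n2-1)\big)}\,\frac{b^{\frac1s(N+\frac n2-1)}\,s}{\pi^{n/2}}.$$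
   Context: The generalized Hurwitz-Lerch zeta function is, for $v\ge 0$, $|z|\le 1$, $z\ne 1$, $\sigma>0$, $\alpha>0$, $$\Phi_v^*(z,\sigma,\alpha)=\frac1{\Gamma(\sigma)}\int_0^\infty\frac{t^{\sigma-1}e^{-\alpha t}}{(1-ze^{-t})^{v}}\,dt .$$ An $n$-dimensional random vector $\mathbf{X}$ is said to have a generalized elliptical logistic distribution $GL_n(\bm\mu,\mathbf\Sigma,g)$ if it has density $f(\mathbf{x})=C_n|\mathbf\Sigma|^{-1/2}g\big((\mathbf{x}-\bm\mu)^T\mathbf\Sigma^{-1}(\mathbf{x}-\bm\mu)\big)$, $\mathbf{x}\in\mathbb{R}^n$, where $g$ is of the form given and $C_n$ is the constant making $f$ integrate to $1$. *)

theory Defs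
  imports "HOL-Probability.Probability"
begin

text \<open>
  The generalized Hurwitz-Lerch zeta function, for \<open>v \<ge> 0\<close>, \<open>\<bar>z\<bar> \<le> 1\<close>, \<open>z \<noteq> 1\<close>,
  \<open>\<sigma> > 0\<close>, \<open>\<alpha> > 0\<close>. The argument \<open>z\<close> is complex; for \<open>t > 0\<close> the base \<open>1 - z e\<^sup>-\<^sup>t\<close> has
  positive real part, so the principal power is the intended one.
\<close>

definition Phi_star :: "real \<Rightarrow> complex \<Rightarrow> real \<Rightarrow> real \<Rightarrow> complex" where
  "Phi_star v z \<sigma> \<alpha> =
     complex_of_real (1 / Gamma \<sigma>) *
     (LBINT t:{0<..}. complex_of_real (t powr (\<sigma> - 1) * exp (- \<alpha> * t)) /
                      (1 - z * complex_of_real (exp (- t))) powr complex_of_real v)"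

definition pos_def_matrix :: "real ^ 'n ^ 'n \<Rightarrow> bool" where
  "pos_def_matrix A \<longleftrightarrow> transpose A = A \<and> (\<forall>x. x \<noteq> 0 \<longrightarrow> x \<bullet> (A *v x) > 0)"

text \<open>
  The value at \<open>t = 0\<close> is irrelevant: as a density generator it is evaluated there only
  at \<open>x = \<mu>\<close>, a null set.
\<close>

definition gen_logistic :: "real \<Rightarrow> real \<Rightarrow> real \<Rightarrow> real \<Rightarrow> real \<Rightarrow> real \<Rightarrow> real" where
  "gen_logistic N a b s r t =
     t powr (N - 1) * exp (- a * t powr s) / (1 + exp (- b * t powr s)) powr (2 * r)"

definition elliptical_kernel ::
    "real ^ 'n \<Rightarrow> real ^ 'n ^ 'n \<Rightarrow> (real \<Rightarrow> real) \<Rightarrow> real ^ 'n \<Rightarrow> real" where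
  "elliptical_kernel \<mu> \<Sigma> g x =
     det \<Sigma> powr (- 1 / 2) * g ((x - \<mu>) \<bullet> (matrix_inv \<Sigma> *v (x - \<mu>)))"

definition normalizing_const ::
    "real ^ 'n \<Rightarrow> real ^ 'n ^ 'n \<Rightarrow> (real \<Rightarrow> real) \<Rightarrow> real" where
  "normalizing_const \<mu> \<Sigma> g =
     (THE C. has_bochner_integral lborel (\<lambda>x. C * elliptical_kernel \<mu> \<Sigma> g x) 1)"

text \<open>
  \<open>GL_distributed M X \<mu> \<Sigma> g\<close> means \<open>X \<sim> GL\<^sub>n(\<mu>, \<Sigma>, g)\<close> with \<open>n = CARD('n)\<close>. Since \<open>M\<close> is a
  probability space, it entails that the density integrates to 1.
\<close>

definition GL_distributed ::
    "'a measure \<Rightarrow> ('a \<Rightarrow> real ^ 'n) \<Rightarrow> real ^ 'n \<Rightarrow> real ^ 'n ^ 'n \<Rightarrow> (real \<Rightarrow> real) \<Rightarrow> bool" where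
  "GL_distributed M X \<mu> \<Sigma> g \<longleftrightarrow>
     prob_space M \<and>
     distributed M lborel X
       (\<lambda>x. ennreal (normalizing_const \<mu> \<Sigma> g * elliptical_kernel \<mu> \<Sigma> g x))"

definition c_star :: "nat \<Rightarrow> real \<Rightarrow> real \<Rightarrow> real \<Rightarrow> real" where
  "c_star n N b s =
     Gamma (real n / 2) / Gamma (1 / s * (N + real n / 2 - 1)) *
     (b powr (1 / s * (N + real n / 2 - 1)) * s / pi powr (real n / 2))"

end

theory Submission
  imports Defs
begin

text \<open>
  The constant is the reciprocal of the integral of the kernel, so the whole content is the value of
  that integral. Write \<open>Q x = (x - \<mu>)\<^sup>T \<Sigma>\<^sup>-\<^sup>1 (x - \<mu>)\<close> and \<open>n = CARD('n)\<close>. The kernel depends on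
  \<open>x\<close> only through \<open>Y = b * Q x powr s\<close>: it is \<open>det \<Sigma> powr (-1/2) * G Y\<close> with
  \<open>G y = (y/b) powr ((N-1)/s) * exp (-(a/b) y) / (1 + exp (-y)) powr (2r)\<close>. Hence it suffices to
  know the image of Lebesgue measure under \<open>Y\<close>, which takes the place of polar coordinates and of
  the substitutions in the radial integral. The condition \<open>Y \<le> y\<close> describes an ellipsoid whose
  volume is a constant times \<open>y powr (n/(2s))\<close> (\<open>emeasure_ellipsoid\<close>), and a measure on the
  half-line with power growth has a power density (\<open>distr_eq_power_density\<close>). The resulting
  integral over \<open>y > 0\<close> (\<open>nn_integral_elliptical\<close>) contains the power of \<open>y\<close> with exponent
  \<open>n/(2s) - 1 + (N-1)/s = \<sigma> - 1\<close>, where \<open>\<sigma> = (N + n/2 - 1)/s\<close>, so it is the one that defines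
  \<open>\<Phi>\<^sup>*\<close> at \<open>z = -1\<close> and \<open>\<alpha> = a/b\<close>.

  The volume of an ellipsoid comes from that of a ball. A basis that is orthonormal for the form
  \<open>\<Sigma>\<close> gives a factorization \<open>\<Sigma>\<^sup>-\<^sup>1 = B B\<^sup>T\<close> (\<open>pos_def_inverse_factorization\<close>), hence \<open>Q x\<close> is the
  squared norm of \<open>B\<^sup>T (x - \<mu>)\<close>, and \<open>nn_integral_lborel_matrix\<close> says that a linear map scales
  Lebesgue measure by its determinant. For coordinates indexed by an arbitrary finite type this is
  shown on elementary matrices, whose only nontrivial case is a shear
  (\<open>nn_integral_lborel_shear\<close>).
\<close>

section \<open>Lebesgue measure under linear maps\<close>

lemma nn_integral_lborel_translate:
  fixes f :: "'a::euclidean_space \<Rightarrow> ennreal"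
  assumes [measurable]: "f \<in> borel_measurable borel"
  shows "(\<integral>\<^sup>+x. f (c + x) \<partial>lborel) = (\<integral>\<^sup>+x. f x \<partial>lborel)"
proof -
  have "(\<integral>\<^sup>+x. f x \<partial>lborel) = (\<integral>\<^sup>+x. f x \<partial>distr lborel borel ((+) c))"
    by (simp add: lborel_distr_plus)
  then show ?thesis
    by (simp add: nn_integral_distr)
qed

text \<open>
  Moving each line in direction \<open>e\<close> along itself, by an amount that depends only on the line, is a
  translation on every such line. Instead of splitting the space into a product, the integral is
  averaged over translations along \<open>e\<close>: after a weight \<open>\<phi>\<close> of total mass 1 is introduced, the
  displacement \<open>h x\<close> is absorbed by translating the averaging variable.
\<close>

lemma nn_integral_lborel_shear:
  fixes g :: "'a::euclidean_space \<Rightarrow> ennreal" and h :: "'a \<Rightarrow> real"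
  assumes [measurable]: "g \<in> borel_measurable borel" "h \<in> borel_measurable borel"
    and e: "e \<bullet> e = 1" and h: "\<And>x t. h (x + t *\<^sub>R e) = h x"
  shows "(\<integral>\<^sup>+x. g (x + h x *\<^sub>R e) \<partial>lborel) = (\<integral>\<^sup>+x. g x \<partial>lborel)"
proof -
  define \<phi> :: "real \<Rightarrow> ennreal" where "\<phi> = indicator {0..1}"
  have [measurable]: "\<phi> \<in> borel_measurable borel"
    unfolding \<phi>_def by simp
  have \<phi>1: "(\<integral>\<^sup>+t. \<phi> (c + t) \<partial>lborel) = 1" for c
    by (subst nn_integral_lborel_translate) (auto simp: \<phi>_def)
  \<comment> \<open>The right-hand side does not mention \<open>k\<close>, so \<open>k = h\<close> and \<open>k = 0\<close> give the same integral.\<close>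
  have averaged: "(\<integral>\<^sup>+x. g (x + k x *\<^sub>R e) \<partial>lborel) =
      (\<integral>\<^sup>+x. \<phi> (x \<bullet> e) * (\<integral>\<^sup>+t. g (x - t *\<^sub>R e) \<partial>lborel) \<partial>lborel)"
    if [measurable]: "k \<in> borel_measurable borel" and k: "\<And>x t. k (x + t *\<^sub>R e) = k x"
    for k :: "'a \<Rightarrow> real"
  proof -
    have k': "k (x - t *\<^sub>R e) = k x" for x t
      using k[of x "- t"] by simp
    have "(\<integral>\<^sup>+x. g (x + k x *\<^sub>R e) \<partial>lborel) =
        (\<integral>\<^sup>+x. (\<integral>\<^sup>+t. g (x + k x *\<^sub>R e) * \<phi> (x \<bullet> e + t) \<partial>lborel) \<partial>lborel)"
      by (simp add: nn_integral_cmult \<phi>1)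
    also have "\<dots> = (\<integral>\<^sup>+t. (\<integral>\<^sup>+x. g (x + k x *\<^sub>R e) * \<phi> (x \<bullet> e + t) \<partial>lborel) \<partial>lborel)"
      by (rule lborel_pair.Fubini'[symmetric]) measurable
    also have "\<dots> = (\<integral>\<^sup>+t. (\<integral>\<^sup>+x. g (x + (k x - t) *\<^sub>R e) * \<phi> (x \<bullet> e) \<partial>lborel) \<partial>lborel)"
    proof (rule nn_integral_cong)
      fix t :: real
      show "(\<integral>\<^sup>+x. g (x + k x *\<^sub>R e) * \<phi> (x \<bullet> e + t) \<partial>lborel) =
            (\<integral>\<^sup>+x. g (x + (k x - t) *\<^sub>R e) * \<phi> (x \<bullet> e) \<partial>lborel)"
        by (subst nn_integral_lborel_translate[of _ "- (t *\<^sub>R e)", symmetric])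
           (simp_all add: k' e inner_diff_left algebra_simps)
    qed
    also have "\<dots> = (\<integral>\<^sup>+x. (\<integral>\<^sup>+t. g (x + (k x - t) *\<^sub>R e) * \<phi> (x \<bullet> e) \<partial>lborel) \<partial>lborel)"
      by (rule lborel_pair.Fubini') measurable
    also have "\<dots> = (\<integral>\<^sup>+x. \<phi> (x \<bullet> e) * (\<integral>\<^sup>+t. g (x - t *\<^sub>R e) \<partial>lborel) \<partial>lborel)"
    proof (rule nn_integral_cong)
      fix x :: 'a
      have "(\<integral>\<^sup>+t. g (x + (k x - t) *\<^sub>R e) \<partial>lborel) = (\<integral>\<^sup>+t. g (x - t *\<^sub>R e) \<partial>lborel)"
        by (subst nn_integral_lborel_translate[of _ "k x", symmetric])
           (simp_all add: algebra_simps)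
      then show "(\<integral>\<^sup>+t. g (x + (k x - t) *\<^sub>R e) * \<phi> (x \<bullet> e) \<partial>lborel) =
          \<phi> (x \<bullet> e) * (\<integral>\<^sup>+t. g (x - t *\<^sub>R e) \<partial>lborel)"
        by (subst nn_integral_multc) (simp_all add: mult.commute)
    qed
    finally show ?thesis .
  qed
  from averaged[of h] averaged[of "\<lambda>_. 0"] h show ?thesis
    by simp
qed

text \<open>
  Both sides are multiplicative in \<open>A\<close>, so elementary matrices suffice: diagonal matrices and
  transpositions of coordinates map boxes to boxes, and adding one coordinate to another is a shear.
\<close>

lemma nn_integral_lborel_matrix:
  fixes A :: "real^'n^'n" and g :: "real^'n \<Rightarrow> ennreal"
  assumes "g \<in> borel_measurable borel" and "det A \<noteq> 0"
  shows "ennreal \<bar>det A\<bar> * (\<integral>\<^sup>+x. g (A *v x) \<partial>lborel) = (\<integral>\<^sup>+x. g x \<partial>lborel)"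
proof -
  \<comment> \<open>Nonsingularity belongs to the induction predicate: a product passes it on to its factors, and
    it excludes matrices with a zero row.\<close>
  define P where "P = (\<lambda>A::real^'n^'n. det A \<noteq> 0 \<longrightarrow> (\<forall>g\<in>borel_measurable borel.
    ennreal \<bar>det A\<bar> * (\<integral>\<^sup>+x. g (A *v x) \<partial>lborel) = (\<integral>\<^sup>+x. g x \<partial>lborel)))"
  have [measurable]: "(*v) A \<in> borel_measurable borel" for A :: "real^'n^'n"
    by (intro borel_measurable_continuous_onI linear_continuous_on)
      (simp add: matrix_vector_mul_bounded_linear)
  have Basis: "Basis = range (\<lambda>i::'n. axis i (1::real))"
    by (auto simp: Basis_vec_def)
  have inj: "inj (\<lambda>i::'n. axis i (1::real))"
    by (auto simp: inj_on_def axis_eq_axis)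
  have "P A"
  proof (rule induct_matrix_elementary_alt)
    fix A B :: "real^'n^'n"
    assume A: "P A" and B: "P B"
    show "P (A ** B)"
      unfolding P_def
    proof (intro impI ballI)
      fix g :: "real^'n \<Rightarrow> ennreal"
      assume [measurable]: "g \<in> borel_measurable borel" and "det (A ** B) \<noteq> 0"
      then have "det A \<noteq> 0" "det B \<noteq> 0"
        by (auto simp: det_mul)
      have [measurable]: "(\<lambda>x. g (A *v x)) \<in> borel_measurable borel"
        by measurable
      have "ennreal \<bar>det (A ** B)\<bar> * (\<integral>\<^sup>+x. g ((A ** B) *v x) \<partial>lborel) =
          ennreal \<bar>det A\<bar> * (ennreal \<bar>det B\<bar> * (\<integral>\<^sup>+x. g (A *v (B *v x)) \<partial>lborel))"
        by (simp add: det_mul abs_mult ennreal_mult mult.assoc matrix_vector_mul_assoc)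
      also have "\<dots> = ennreal \<bar>det A\<bar> * (\<integral>\<^sup>+x. g (A *v x) \<partial>lborel)"
        using B[unfolded P_def, rule_format, of "\<lambda>x. g (A *v x)"] \<open>det B \<noteq> 0\<close> by simp
      also have "\<dots> = (\<integral>\<^sup>+x. g x \<partial>lborel)"
        using A[unfolded P_def] \<open>det A \<noteq> 0\<close> by simp
      finally show "ennreal \<bar>det (A ** B)\<bar> * (\<integral>\<^sup>+x. g ((A ** B) *v x) \<partial>lborel) = \<dots>" .
    qed
  next
    fix A :: "real^'n^'n" and i
    assume "row i A = 0"
    then show "P A"
      unfolding P_def using det_zero_row(2)[of i A] by (auto simp: row_def vec_eq_iff)
  next
    fix A :: "real^'n^'n"
    assume diag: "\<And>i j. i \<noteq> j \<Longrightarrow> A $ i $ j = 0"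
    show "P A"
      unfolding P_def
    proof (intro impI ballI)
      fix g :: "real^'n \<Rightarrow> ennreal"
      assume [measurable]: "g \<in> borel_measurable borel" and "det A \<noteq> 0"
      define c where "c b = (A *v b) \<bullet> b" for b
      have det: "det A = (\<Prod>i\<in>UNIV. A $ i $ i)"
        by (rule det_diagonal) (rule diag)
      have c_axis: "c (axis i 1) = A $ i $ i" for i
        by (simp add: c_def matrix_vector_mult_basis column_def inner_axis)
      have "c j \<noteq> 0" if "j \<in> Basis" for j
        using that \<open>det A \<noteq> 0\<close> c_axis unfolding det by (auto simp: Basis_vec_def)
      note aff = lborel_affine_euclidean[of c 0, OF this, simplified]
      have "(\<Prod>j\<in>Basis. \<bar>c j\<bar>) = \<bar>det A\<bar>"
        unfolding det abs_prod Basis by (simp add: prod.reindex inj c_axis)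
      moreover have "(\<Sum>j\<in>Basis. (c j * (x \<bullet> j)) *\<^sub>R j) = A *v x" for x
      proof -
        have "(\<Sum>j\<in>Basis. (c j * (x \<bullet> j)) *\<^sub>R j) = (\<Sum>i\<in>UNIV. (A $ i $ i * x $ i) *\<^sub>R axis i 1)"
          unfolding Basis by (simp add: sum.reindex inj c_axis inner_axis)
        also have "\<dots> = A *v x"
        proof (rule vec_eq_iff[THEN iffD2], rule allI)
          fix k
          have "(A *v x) $ k = (\<Sum>j\<in>UNIV. if j = k then A $ k $ k * x $ k else 0)"
            unfolding matrix_vector_mult_def vec_lambda_beta by (rule sum.cong) (auto simp: diag)
          then show "(\<Sum>i\<in>UNIV. (A $ i $ i * x $ i) *\<^sub>R axis i 1) $ k = (A *v x) $ k"
            by (simp add: axis_def if_distrib cong: if_cong)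
        qed
        finally show ?thesis .
      qed
      ultimately have "lborel = density (distr lborel borel ((*v) A)) (\<lambda>_. ennreal \<bar>det A\<bar>)"
        using aff by (simp add: fun_eq_iff)
      then have "(\<integral>\<^sup>+x. g x \<partial>lborel) =
        (\<integral>\<^sup>+x. g x \<partial>density (distr lborel borel ((*v) A)) (\<lambda>_. ennreal \<bar>det A\<bar>))"
        by (rule arg_cong)
      then show "ennreal \<bar>det A\<bar> * (\<integral>\<^sup>+x. g (A *v x) \<partial>lborel) = (\<integral>\<^sup>+x. g x \<partial>lborel)"
        by (simp add: nn_integral_density nn_integral_distr nn_integral_cmult)
    qed
  next
    fix m n :: 'n
    assume "m \<noteq> n"
    let ?S = "\<chi> i j. mat 1 $ i $ Transposition.transpose m n j :: real^'n^'n"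
    let ?\<tau> = "Transposition.transpose m n"
    let ?h = "\<lambda>x::real^'n. \<chi> i. x $ ?\<tau> i"
    have perm: "?\<tau> permutes UNIV"
      by (rule permutes_swap_id) simp_all
    have Sv: "?S *v x = ?h x" for x
    proof (rule vec_eq_iff[THEN iffD2], rule allI)
      fix i
      have "(?S *v x) $ i = (\<Sum>j\<in>UNIV. if j = ?\<tau> i then x $ j else 0)"
        unfolding matrix_vector_mult_def mat_def vec_lambda_beta
        by (rule sum.cong) auto
      then show "(?S *v x) $ i = ?h x $ i"
        by simp
    qed
    have det: "\<bar>det ?S\<bar> = 1"
      by (simp add: det_permute_columns[OF perm] sign_swap_id \<open>m \<noteq> n\<close>)
    have eq: "lborel = distr lborel borel ((*v) ?S)"
    proof (rule lborel_eqI)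
      fix l u :: "real^'n"
      assume le: "\<And>b. b \<in> Basis \<Longrightarrow> l \<bullet> b \<le> u \<bullet> b"
      have le': "l $ i \<le> u $ i" for i
        using le[of "axis i 1"] by (simp add: Basis inner_axis)
      have "(*v) ?S -` box l u = box (?h l) (?h u)"
        unfolding Sv by (auto simp: mem_box_cart) (metis transpose_involutory)+
      then have "emeasure (distr lborel borel ((*v) ?S)) (box l u) = emeasure lborel (box (?h l) (?h u))"
        by (simp add: emeasure_distr)
      also have "\<dots> = ennreal (\<Prod>i\<in>UNIV. (u - l) $ ?\<tau> i)"
        using le' by (subst emeasure_lborel_box) (auto simp: Basis prod.reindex inj inner_axis)
      also have "(\<Prod>i\<in>UNIV. (u - l) $ ?\<tau> i) = (\<Prod>i\<in>UNIV. (u - l) $ i)"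
        using prod.permute[OF perm, of "\<lambda>i. (u - l) $ i"] by (simp add: o_def)
      also have "\<dots> = (\<Prod>b\<in>Basis. (u - l) \<bullet> b)"
        by (simp add: Basis prod.reindex inj inner_axis)
      finally show "emeasure (distr lborel borel ((*v) ?S)) (box l u) = (\<Prod>b\<in>Basis. (u - l) \<bullet> b)" .
    qed simp
    show "P ?S"
      unfolding P_def
    proof (intro impI ballI)
      fix g :: "real^'n \<Rightarrow> ennreal"
      assume [measurable]: "g \<in> borel_measurable borel"
      have "(\<integral>\<^sup>+x. g x \<partial>lborel) = (\<integral>\<^sup>+x. g x \<partial>distr lborel borel ((*v) ?S))"
        using eq by (rule arg_cong)
      then show "ennreal \<bar>det ?S\<bar> * (\<integral>\<^sup>+x. g (?S *v x) \<partial>lborel) = (\<integral>\<^sup>+x. g x \<partial>lborel)"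
        unfolding det by (simp add: nn_integral_distr)
    qed
  next
    fix m n :: 'n
    assume "m \<noteq> n"
    let ?E = "\<chi> i j. of_bool (i = m \<and> j = n \<or> i = j) :: real^'n^'n"
    have "(\<chi> k. if k = m then row m (mat 1) + 1 *s row n (mat 1) else row k (mat 1)) = ?E"
      using \<open>m \<noteq> n\<close> by (auto simp: vec_eq_iff row_def mat_def)
    then have det: "det ?E = 1"
      using det_row_operation[OF \<open>m \<noteq> n\<close>, of "mat 1 :: real^'n^'n" 1] by simp
    have Ev: "?E *v x = x + (x $ n) *\<^sub>R axis m 1" for x
    proof (rule vec_eq_iff[THEN iffD2], rule allI)
      fix i
      have "(?E *v x) $ i = (\<Sum>j\<in>UNIV. (if j = i then x $ i else 0) + (if j = n then if i = m then x $ n else 0 else 0))"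
        unfolding matrix_vector_mult_def vec_lambda_beta
        using \<open>m \<noteq> n\<close> by (intro sum.cong) auto
      then show "(?E *v x) $ i = (x + (x $ n) *\<^sub>R axis m 1) $ i"
        by (simp add: sum.distrib axis_def)
    qed
    have "axis m 1 \<bullet> axis m (1::real) = 1"
      by (simp add: inner_axis_axis)
    moreover have "(axis m 1 :: real^'n) $ n = 0"
      using \<open>m \<noteq> n\<close> by (simp add: axis_def)
    ultimately show "P ?E"
      unfolding P_def det Ev by (auto intro!: nn_integral_lborel_shear)
  qed
  with assms show ?thesis
    by (auto simp: P_def)
qed

section \<open>Positive definite matrices and ellipsoids\<close>

text \<open>
  Gram-Schmidt for the inner product \<open>x \<bullet> (\<Sigma> *v y)\<close>. A family indexed by a proper subset of the
  coordinates is too small to have all of the space as the span of its images under \<open>\<Sigma>\<close>, so some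
  nonzero vector is orthogonal to them, and it only has to be rescaled.
\<close>

lemma pos_def_orthonormal_family:
  fixes \<Sigma> :: "real^'n^'n"
  assumes pd: "pos_def_matrix \<Sigma>" and "finite S"
  shows "\<exists>v::'n \<Rightarrow> real^'n. \<forall>i\<in>S. \<forall>j\<in>S. v i \<bullet> (\<Sigma> *v v j) = of_bool (i = j)"
  using \<open>finite S\<close>
proof induction
  case empty
  then show ?case by simp
next
  case (insert k S)
  then obtain v :: "'n \<Rightarrow> real^'n"
    where v: "\<And>i j. i \<in> S \<Longrightarrow> j \<in> S \<Longrightarrow> v i \<bullet> (\<Sigma> *v v j) = of_bool (i = j)"
    by blast
  have sym: "x \<bullet> (\<Sigma> *v y) = y \<bullet> (\<Sigma> *v x)" for x y
    using pd by (metis dot_lmul_matrix inner_commute pos_def_matrix_def transpose_matrix_vector)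
  have "dim ((\<lambda>i. \<Sigma> *v v i) ` S) \<le> card S"
    using insert.hyps by (meson card_image_le dim_le_card' finite_imageI le_trans)
  also have "card S < CARD('n)"
    using insert.hyps by (intro psubset_card_mono) auto
  finally obtain x where "x \<noteq> 0" and orth: "\<And>y. y \<in> span ((\<lambda>i. \<Sigma> *v v i) ` S) \<Longrightarrow> orthogonal x y"
    using orthogonal_to_subspace_exists[of "(\<lambda>i. \<Sigma> *v v i) ` S"] by auto
  have x0: "x \<bullet> (\<Sigma> *v v i) = 0" if "i \<in> S" for i
    using orth[OF span_base] that by (auto simp: orthogonal_def)
  define q where "q = x \<bullet> (\<Sigma> *v x)"
  have "q > 0"
    using pd \<open>x \<noteq> 0\<close> by (simp add: q_def pos_def_matrix_def)
  define w where "w = v(k := (1 / sqrt q) *\<^sub>R x)"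
  have wk: "w k = (1 / sqrt q) *\<^sub>R x" and wi: "\<And>i. i \<in> S \<Longrightarrow> w i = v i"
    using insert.hyps by (auto simp: w_def)
  have "w i \<bullet> (\<Sigma> *v w j) = of_bool (i = j)" if "i \<in> insert k S" "j \<in> insert k S" for i j
  proof -
    have kk: "w k \<bullet> (\<Sigma> *v w k) = 1"
      using \<open>q > 0\<close> by (simp add: wk scaleR_matrix_vector_assoc[symmetric] matrix_vector_mult_scaleR
          q_def[symmetric] real_div_sqrt field_simps)
    have ki: "w k \<bullet> (\<Sigma> *v w i) = 0" if "i \<in> S" for i
      using that by (simp add: wk wi x0)
    show ?thesis
      using that kk ki ki[unfolded sym[of "w k"]] v wi insert.hyps(2)
      by (cases "i = k"; cases "j = k") auto
  qed
  then show ?case by blast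
qed

text \<open>The columns of \<open>B\<close> form a basis that is orthonormal for \<open>\<Sigma>\<close>.\<close>

lemma pos_def_congruent_identity:
  fixes \<Sigma> :: "real^'n^'n"
  assumes "pos_def_matrix \<Sigma>"
  obtains B :: "real^'n^'n" where "transpose B ** \<Sigma> ** B = mat 1"
proof -
  obtain v :: "'n \<Rightarrow> real^'n" where v: "\<And>i j. v i \<bullet> (\<Sigma> *v v j) = of_bool (i = j)"
    using pos_def_orthonormal_family[OF assms, of UNIV] by auto
  define B :: "real^'n^'n" where "B = (\<chi> i j. v j $ i)"
  have Bv: "B *v axis j 1 = v j" for j
    by (simp add: matrix_vector_mult_basis column_def B_def vec_eq_iff)
  have "(transpose B ** \<Sigma> ** B) $ i $ j = (mat 1 :: real^'n^'n) $ i $ j" for i j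
  proof -
    have "(transpose B ** \<Sigma> ** B) $ i $ j = ((transpose B ** \<Sigma> ** B) *v axis j 1) $ i"
      by (simp add: matrix_vector_mult_basis column_def)
    also have "\<dots> = axis i 1 \<bullet> (transpose B *v (\<Sigma> *v v j))"
      by (simp add: inner_axis' Bv flip: matrix_vector_mul_assoc)
    also have "\<dots> = v i \<bullet> (\<Sigma> *v v j)"
      by (metis Bv dot_lmul_matrix inner_commute transpose_matrix_vector)
    finally show ?thesis
      by (simp add: v mat_def)
  qed
  then have "transpose B ** \<Sigma> ** B = mat 1"
    by (simp add: vec_eq_iff)
  then show ?thesis ..
qed

text \<open>
  Inverting \<open>B\<^sup>T \<Sigma> B = 1\<close> turns the basis that is orthonormal for \<open>\<Sigma>\<close> into a factorization of
  \<open>\<Sigma>\<^sup>-\<^sup>1\<close>, and taking determinants relates \<open>B\<close> to \<open>\<Sigma>\<close>.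
\<close>

lemma pos_def_inverse_factorization:
  fixes \<Sigma> :: "real^'n^'n"
  assumes "pos_def_matrix \<Sigma>"
  obtains B :: "real^'n^'n" where "matrix_inv \<Sigma> = B ** transpose B" and "(det B)\<^sup>2 * det \<Sigma> = 1"
proof -
  obtain B :: "real^'n^'n" where B: "transpose B ** \<Sigma> ** B = mat 1"
    by (rule pos_def_congruent_identity[OF assms])
  have "transpose B ** (\<Sigma> ** B) = mat 1"
    using B by (simp add: matrix_mul_assoc)
  then have "\<Sigma> ** B ** transpose B = mat 1"
    by (rule matrix_left_right_inverse1)
  then have right: "\<Sigma> ** (B ** transpose B) = mat 1"
    by (simp add: matrix_mul_assoc)
  then have left: "(B ** transpose B) ** \<Sigma> = mat 1"
    by (rule matrix_left_right_inverse1)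
  have "\<Sigma> ** matrix_inv \<Sigma> = mat 1 \<and> matrix_inv \<Sigma> ** \<Sigma> = mat 1"
    unfolding matrix_inv_def
    by (rule someI[of "\<lambda>A. \<Sigma> ** A = mat 1 \<and> A ** \<Sigma> = mat 1"]) (use right left in blast)
  then have "matrix_inv \<Sigma> ** (\<Sigma> ** (B ** transpose B)) = B ** transpose B"
    by (simp add: matrix_mul_assoc)
  then have inv: "matrix_inv \<Sigma> = B ** transpose B"
    unfolding right by simp
  have "det (transpose B ** \<Sigma> ** B) = 1"
    by (simp add: B)
  then have "(det B)\<^sup>2 * det \<Sigma> = 1"
    by (simp add: det_mul det_transpose power2_eq_square mult_ac)
  with inv show ?thesis
    by (rule that)
qed

lemma pos_def_det_pos:
  fixes \<Sigma> :: "real^'n^'n"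
  assumes "pos_def_matrix \<Sigma>"
  shows "det \<Sigma> > 0"
proof -
  obtain B :: "real^'n^'n" where "(det B)\<^sup>2 * det \<Sigma> = 1"
    using pos_def_inverse_factorization[OF assms] by blast
  then show ?thesis
    by (smt (verit) mult_nonneg_nonpos zero_le_power2)
qed

lemma inner_mult_transpose_eq_norm:
  fixes B :: "real^'n^'m"
  shows "y \<bullet> ((B ** transpose B) *v y) = (norm (transpose B *v y))\<^sup>2"
proof -
  have "y \<bullet> ((B ** transpose B) *v y) = y \<bullet> (B *v (transpose B *v y))"
    by (simp only: matrix_vector_mul_assoc)
  also have "\<dots> = (transpose B *v y) \<bullet> (transpose B *v y)"
    by (simp only: transpose_matrix_vector dot_lmul_matrix)
  finally show ?thesis
    by (simp only: power2_norm_eq_inner)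
qed

lemma pos_def_inverse_form_nonneg:
  fixes \<Sigma> :: "real^'n^'n"
  assumes "pos_def_matrix \<Sigma>"
  shows "0 \<le> y \<bullet> (matrix_inv \<Sigma> *v y)"
proof -
  obtain B :: "real^'n^'n" where "matrix_inv \<Sigma> = B ** transpose B"
    using pos_def_inverse_factorization[OF assms] by blast
  then show ?thesis
    by (simp only: inner_mult_transpose_eq_norm zero_le_power2)
qed

lemma borel_measurable_quadratic_form:
  fixes A :: "real^'n^'n" and \<mu> :: "real^'n"
  shows "(\<lambda>x. (x - \<mu>) \<bullet> (A *v (x - \<mu>))) \<in> borel_measurable borel"
proof (rule borel_measurable_continuous_onI)
  have "continuous_on UNIV (\<lambda>x. A *v (x - \<mu>))"
    using continuous_on_compose2[of UNIV "(*v) A" UNIV "\<lambda>x. x - \<mu>"]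
    by (simp add: matrix_vector_mult_linear_continuous_on continuous_intros)
  then show "continuous_on UNIV (\<lambda>x. (x - \<mu>) \<bullet> (A *v (x - \<mu>)))"
    by (intro continuous_intros)
qed

text \<open>
  With \<open>\<Sigma>\<^sup>-\<^sup>1 = B B\<^sup>T\<close> the ellipsoid is, up to translation, the preimage under \<open>B\<^sup>T\<close> of the ball of
  radius \<open>sqrt t\<close>, and \<open>\<bar>det B\<bar>\<close> is the reciprocal of \<open>sqrt (det \<Sigma>)\<close>.
\<close>

lemma emeasure_ellipsoid:
  fixes \<Sigma> :: "real^'n^'n" and \<mu> :: "real^'n"
  assumes pd: "pos_def_matrix \<Sigma>" and "0 \<le> t"
  shows "emeasure lborel {x. (x - \<mu>) \<bullet> (matrix_inv \<Sigma> *v (x - \<mu>)) \<le> t} =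
      ennreal (sqrt (det \<Sigma>) * unit_ball_vol CARD('n) * t powr (CARD('n) / 2))" (is "emeasure lborel ?E = _")
proof -
  obtain B :: "real^'n^'n" where inv: "matrix_inv \<Sigma> = B ** transpose B"
    and det: "(det B)\<^sup>2 * det \<Sigma> = 1"
    by (rule pos_def_inverse_factorization[OF pd])
  have "det \<Sigma> > 0"
    by (rule pos_def_det_pos[OF pd])
  have "det B \<noteq> 0"
    using det by auto
  have sd: "sqrt (det \<Sigma>) * \<bar>det B\<bar> = 1"
    using arg_cong[OF det, of sqrt] by (simp add: real_sqrt_mult mult.commute)
  have mem: "\<mu> + x \<in> ?E \<longleftrightarrow> transpose B *v x \<in> cball 0 (sqrt t)" for x
    using \<open>0 \<le> t\<close> by (simp add: inv inner_mult_transpose_eq_norm sqrt_ge_absD real_le_rsqrt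
        real_sqrt_le_iff[of "_\<^sup>2" t, symmetric] del: real_sqrt_le_iff)
  have [measurable]: "(\<lambda>x. (x - \<mu>) \<bullet> (matrix_inv \<Sigma> *v (x - \<mu>))) \<in> borel_measurable borel"
    by (rule borel_measurable_quadratic_form)
  have [measurable]: "?E \<in> sets borel"
    by measurable
  have "emeasure lborel ?E = (\<integral>\<^sup>+x. indicator ?E (\<mu> + x) \<partial>lborel)"
    by (subst nn_integral_lborel_translate) simp_all
  also have "\<dots> = (\<integral>\<^sup>+x. indicator (cball 0 (sqrt t)) (transpose B *v x) \<partial>lborel)"
    by (simp add: indicator_def mem del: mem_Collect_eq mem_cball)
  also have "\<dots> = ennreal (sqrt (det \<Sigma>)) * (ennreal \<bar>det B\<bar> * \<dots>)"
    using sd \<open>det \<Sigma> > 0\<close> by (simp flip: mult.assoc ennreal_mult)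
  also have "ennreal \<bar>det B\<bar> * (\<integral>\<^sup>+x. indicator (cball 0 (sqrt t)) (transpose B *v x) \<partial>lborel) =
      (\<integral>\<^sup>+x. indicator (cball 0 (sqrt t)) (x::real^'n) \<partial>lborel)"
  proof -
    have "(indicator (cball 0 (sqrt t)) :: real^'n \<Rightarrow> ennreal) \<in> borel_measurable borel"
      by (intro borel_measurable_indicator) simp
    moreover have "det (transpose B) \<noteq> 0"
      using \<open>det B \<noteq> 0\<close> by (simp only: det_transpose not_False_eq_True)
    ultimately have "ennreal \<bar>det (transpose B)\<bar> *
        (\<integral>\<^sup>+x. indicator (cball 0 (sqrt t)) (transpose B *v x) \<partial>lborel) =
        (\<integral>\<^sup>+x. indicator (cball 0 (sqrt t)) (x::real^'n) \<partial>lborel)"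
      by (rule nn_integral_lborel_matrix)
    then show ?thesis
      by (simp only: det_transpose)
  qed
  also have "\<dots> = ennreal (unit_ball_vol CARD('n) * sqrt t ^ CARD('n))"
    using \<open>0 \<le> t\<close> by (simp add: emeasure_cball)
  also have "sqrt t ^ CARD('n) = t powr (CARD('n) / 2)"
    using \<open>0 \<le> t\<close> by (cases "t = 0") (simp_all add: powr_half_sqrt[symmetric] powr_power)
  also have "ennreal (sqrt (det \<Sigma>)) * ennreal (unit_ball_vol CARD('n) * t powr (CARD('n) / 2)) =
      ennreal (sqrt (det \<Sigma>) * unit_ball_vol CARD('n) * t powr (CARD('n) / 2))"
    using \<open>det \<Sigma> > 0\<close> by (simp add: mult.assoc flip: ennreal_mult)
  finally show "emeasure lborel ?E = \<dots>" .
qed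

section \<open>Integrals of elliptically contoured functions\<close>

text \<open>
  A measure on the line is determined by its finite values on the half-lines \<open>{..a}\<close>, and
  \<open>K * a powr p\<close> is the integral over \<open>{0..a}\<close> of its derivative \<open>K * p * y powr (p - 1)\<close>, also
  when \<open>p < 1\<close> makes the derivative unbounded near 0, as for \<open>n = 1\<close> and \<open>s = 1\<close> below.
\<close>

lemma distr_eq_power_density:
  fixes h :: "'a \<Rightarrow> real"
  assumes h [measurable]: "h \<in> borel_measurable M" and nonneg: "\<And>x. x \<in> space M \<Longrightarrow> 0 \<le> h x"
    and "K \<ge> 0" "p > 0"
    and growth: "\<And>y. 0 \<le> y \<Longrightarrow> emeasure M {x \<in> space M. h x \<le> y} = ennreal (K * y powr p)"
  shows "distr M borel h =
    density lborel (\<lambda>y. ennreal (K * p * y powr (p - 1) * indicator {0<..} y))" (is "?L = ?R")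
proof (rule measure_eqI_generator_eq_countable)
  let ?E = "range (\<lambda>a::real. {..a})"
  show "Int_stable ?E"
    by (auto simp: Int_stable_def)
  show "?E \<subseteq> Pow UNIV" "sets ?L = sigma_sets UNIV ?E" "sets ?R = sigma_sets UNIV ?E"
    by (simp_all add: borel_eq_atMost)
  have cdf: "emeasure ?L {..a} = (if a < 0 then 0 else ennreal (K * a powr p))" for a
  proof -
    have "h -` {..a} \<inter> space M = {x \<in> space M. h x \<le> a}"
      by auto
    moreover have "{x \<in> space M. h x \<le> a} = {}" if "a < 0"
      using that nonneg by force
    ultimately show ?thesis
      using growth[of a] by (cases "a < 0") (simp_all add: emeasure_distr del: Collect_empty_eq)
  qed
  have "emeasure ?R {..a} = (if a < 0 then 0 else ennreal (K * a powr p))" for a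
  proof -
    let ?f = "\<lambda>y::real. K * p * (indicator {0..a} y * y powr (p - 1))"
    have "emeasure ?R {..a} = (\<integral>\<^sup>+y. ennreal (?f y) \<partial>lborel)"
      by (subst emeasure_density) (auto intro!: nn_integral_cong simp: indicator_def)
    also have "\<dots> = ennreal (if a < 0 then 0 else K * a powr p)"
    proof (rule nn_integral_has_integral_lborel)
      show "?f \<in> borel_measurable borel"
        by measurable
      show "0 \<le> ?f y" for y
        using \<open>K \<ge> 0\<close> \<open>p > 0\<close> by simp
      show "(?f has_integral (if a < 0 then 0 else K * a powr p)) UNIV"
      proof (cases "a < 0")
        case False
        have "((\<lambda>y. y powr (p - 1)) has_integral (a powr p / p)) {0..a}"
          using has_integral_powr_from_0[of "p - 1" a] \<open>p > 0\<close> False by simp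
        then have "((\<lambda>y. if y \<in> {0..a} then y powr (p - 1) else 0) has_integral (a powr p / p)) UNIV"
          by (simp only: has_integral_restrict_UNIV)
        moreover have "(\<lambda>y. if y \<in> {0..a} then y powr (p - 1) else 0) =
            (\<lambda>y. indicator {0..a} y * y powr (p - 1))"
          by auto
        ultimately have "((\<lambda>y. indicator {0..a} y * y powr (p - 1)) has_integral (a powr p / p)) UNIV"
          by simp
        from has_integral_mult_right[OF this, of "K * p"] show ?thesis
          using False \<open>p > 0\<close> by simp
      qed simp
    qed
    finally show ?thesis by simp
  qed
  with cdf show "emeasure ?L X = emeasure ?R X" if "X \<in> ?E" for X
    using that by auto
  show "(\<lambda>n::nat. {..real n}) ` UNIV \<subseteq> ?E" "countable ((\<lambda>n::nat. {..real n}) ` UNIV)"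
    by auto
  show "\<Union> ((\<lambda>n::nat. {..real n}) ` UNIV) = UNIV"
    using real_arch_simple by auto
  show "emeasure ?L X \<noteq> \<infinity>" if "X \<in> (\<lambda>n::nat. {..real n}) ` UNIV" for X
    using that by (auto simp: cdf)
qed

text \<open>
  The sublevel sets of \<open>b * Q x powr s\<close> are the ellipsoids \<open>Q x \<le> (y/b) powr (1/s)\<close>, so the
  two substitutions \<open>t = \<parallel>x\<parallel>\<^sup>2\<close> and \<open>y = b t\<^sup>s\<close> of the usual computation are made at once. The
  constant is the volume of the unit ball times \<open>p\<close>, rewritten with the recursion of \<open>\<Gamma>\<close>.
\<close>

lemma nn_integral_elliptical:
  fixes \<Sigma> :: "real^'n^'n" and \<mu> :: "real^'n" and G :: "real \<Rightarrow> ennreal"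
  assumes pd: "pos_def_matrix \<Sigma>" and "b > 0" "s > 0" and [measurable]: "G \<in> borel_measurable borel"
  defines "p \<equiv> CARD('n) / (2 * s)"
  shows "(\<integral>\<^sup>+x. G (b * ((x - \<mu>) \<bullet> (matrix_inv \<Sigma> *v (x - \<mu>))) powr s) \<partial>lborel) =
    (\<integral>\<^sup>+y\<in>{0<..}. ennreal (sqrt (det \<Sigma>) * pi powr (CARD('n) / 2) / (Gamma (CARD('n) / 2) * s) *
        b powr (- p) * y powr (p - 1)) * G y \<partial>lborel)"
proof -
  define Q where "Q x = (x - \<mu>) \<bullet> (matrix_inv \<Sigma> *v (x - \<mu>))" for x
  have [measurable]: "Q \<in> borel_measurable borel"
    unfolding Q_def by (rule borel_measurable_quadratic_form)
  have Q0: "0 \<le> Q x" for x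
    unfolding Q_def by (rule pos_def_inverse_form_nonneg[OF pd])
  have det: "det \<Sigma> > 0"
    by (rule pos_def_det_pos[OF pd])
  have "p > 0"
    using \<open>s > 0\<close> by (simp add: p_def)
  define K where "K = sqrt (det \<Sigma>) * unit_ball_vol CARD('n) * b powr (- p)"
  have "K \<ge> 0"
    using det by (simp add: K_def)
  have distr: "distr lborel borel (\<lambda>x. b * Q x powr s) =
    density lborel (\<lambda>y. ennreal (K * p * y powr (p - 1) * indicator {0<..} y))"
  proof (rule distr_eq_power_density)
    show "0 \<le> b * Q x powr s" for x
      using \<open>b > 0\<close> by simp
    fix y :: real
    assume "0 \<le> y"
    have "b * Q x powr s \<le> y \<longleftrightarrow> Q x \<le> (y / b) powr (1 / s)" for x
    proof -
      have "b * Q x powr s \<le> y \<longleftrightarrow> Q x powr s \<le> y / b"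
        using \<open>b > 0\<close> by (simp add: field_simps)
      also have "\<dots> \<longleftrightarrow> Q x powr s \<le> ((y / b) powr (1 / s)) powr s"
        using \<open>b > 0\<close> \<open>s > 0\<close> \<open>0 \<le> y\<close> by (simp add: powr_powr)
      also have "\<dots> \<longleftrightarrow> Q x \<le> (y / b) powr (1 / s)"
        using \<open>s > 0\<close> Q0 by (meson not_le powr_ge_zero powr_less_mono2 powr_mono2 less_imp_le)
      finally show ?thesis .
    qed
    then have "emeasure lborel {x \<in> space lborel. b * Q x powr s \<le> y} =
        emeasure lborel {x. Q x \<le> (y / b) powr (1 / s)}"
      by simp
    also have "\<dots> = ennreal (sqrt (det \<Sigma>) * unit_ball_vol CARD('n) *
        ((y / b) powr (1 / s)) powr (CARD('n) / 2))"
      unfolding Q_def by (rule emeasure_ellipsoid[OF pd]) simp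
    also have "((y / b) powr (1 / s)) powr (CARD('n) / 2) = b powr (- p) * y powr p"
      using \<open>b > 0\<close> \<open>0 \<le> y\<close> by (simp add: powr_powr p_def powr_divide powr_minus field_simps)
    finally show "emeasure lborel {x \<in> space lborel. b * Q x powr s \<le> y} = ennreal (K * y powr p)"
      by (simp add: K_def mult.assoc)
  qed (use \<open>K \<ge> 0\<close> \<open>p > 0\<close> in simp_all)
  have "(\<integral>\<^sup>+x. G (b * Q x powr s) \<partial>lborel) = (\<integral>\<^sup>+y. G y \<partial>distr lborel borel (\<lambda>x. b * Q x powr s))"
    by (simp add: nn_integral_distr)
  also have "\<dots> = (\<integral>\<^sup>+y. ennreal (K * p * y powr (p - 1) * indicator {0<..} y) * G y \<partial>lborel)"
    unfolding distr by (rule nn_integral_density) simp_all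
  also have "\<dots> = (\<integral>\<^sup>+y\<in>{0<..}. ennreal (K * p * y powr (p - 1)) * G y \<partial>lborel)"
    by (intro nn_integral_cong) (simp add: indicator_def)
  also have "unit_ball_vol CARD('n) * p = pi powr (CARD('n) / 2) / (Gamma (CARD('n) / 2) * s)"
  proof -
    have "Gamma (real CARD('n) / 2 + 1) = CARD('n) / 2 * Gamma (CARD('n) / 2)"
      by (rule Gamma_plus1) (auto dest!: nonpos_Ints_nonpos)
    then show ?thesis
      using \<open>s > 0\<close> by (simp add: unit_ball_vol_def p_def field_simps)
  qed
  then have "K * p = sqrt (det \<Sigma>) * pi powr (CARD('n) / 2) / (Gamma (CARD('n) / 2) * s) * b powr (- p)"
    unfolding K_def by (metis (no_types, opaque_lifting) mult.assoc mult.commute times_divide_eq_right)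
  finally show ?thesis
    unfolding Q_def .
qed

section \<open>The Hurwitz-Lerch integral at -1\<close>

text \<open>The denominator is at least 1, so Euler's integral for \<open>\<Gamma>\<close> dominates.\<close>

lemma set_integrable_Phi_star_kernel:
  assumes "\<sigma> > 0" "\<alpha> > 0" "v \<ge> 0"
  shows "set_integrable lborel {0<..}
    (\<lambda>t::real. t powr (\<sigma> - 1) * exp (- \<alpha> * t) / (1 + exp (- t)) powr v)"
proof -
  have "(\<lambda>t. complex_of_real t powr (of_real \<sigma> - 1) / of_real (exp (\<alpha> * t))) absolutely_integrable_on {0<..}"
    using assms by (intro absolutely_integrable_Gamma_integral) auto
  then have "set_integrable lebesgue {0<..} (\<lambda>t. norm (complex_of_real t powr (of_real \<sigma> - 1) / of_real (exp (\<alpha> * t))))"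
    by (rule set_integrable_norm)
  then have "set_integrable lebesgue {0<..} (\<lambda>t. t powr (\<sigma> - 1) * exp (- \<alpha> * t))"
    by (rule set_integrable_cong[THEN iffD1, rotated -1])
      (auto simp: norm_divide norm_powr_real_powr exp_minus field_simps)
  then have "set_integrable lborel {0<..} (\<lambda>t. t powr (\<sigma> - 1) * exp (- \<alpha> * t))"
    unfolding set_integrable_def by (subst (asm) integrable_completion) measurable
  then show ?thesis
  proof (rule set_integrable_bound)
    show "set_borel_measurable lborel {0<..}
      (\<lambda>t::real. t powr (\<sigma> - 1) * exp (- \<alpha> * t) / (1 + exp (- t)) powr v)"
      unfolding set_borel_measurable_def by measurable
    have "x / (1 + exp (- t)) powr v \<le> x" if "0 \<le> x" for x t :: real
    proof -
      have "1 \<le> (1 + exp (- t)) powr v"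
        using \<open>v \<ge> 0\<close> by (intro ge_one_powr_ge_zero) auto
      from frac_le[OF that order_refl _ this] show ?thesis
        by simp
    qed
    then show "AE t in lborel. t \<in> {0<..} \<longrightarrow>
      norm (t powr (\<sigma> - 1) * exp (- \<alpha> * t) / (1 + exp (- t)) powr v) \<le> norm (t powr (\<sigma> - 1) * exp (- \<alpha> * t))"
      by (intro AE_I2 impI) (simp add: abs_mult)
  qed
qed

lemma set_integral_halfline_pos:
  fixes F :: "real \<Rightarrow> real"
  assumes int: "set_integrable lborel {0<..} F" and pos: "\<And>t. 0 < t \<Longrightarrow> 0 < F t"
  shows "0 < (LBINT t:{0<..}. F t)"
proof -
  have nonneg: "0 \<le> indicator {0<..} t *\<^sub>R F t" for t
    using pos[of t] by (auto simp: indicator_def less_imp_le)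
  have "(LBINT t:{0<..}. F t) \<noteq> 0"
  proof
    assume "(LBINT t:{0<..}. F t) = 0"
    then have "AE t in lborel. indicator {0<..} t *\<^sub>R F t = 0"
      using integral_nonneg_eq_0_iff_AE[OF int[unfolded set_integrable_def]] nonneg
      by (simp add: set_lebesgue_integral_def)
    moreover have "t \<notin> {0<..}" if "indicator {0<..} t *\<^sub>R F t = 0" for t
      using that pos[of t] by (auto simp: indicator_def split: if_splits)
    ultimately have "AE t::real in lborel. t \<notin> {0<..}"
      by (rule eventually_mono)
    then have "{0<..} \<in> null_sets (lborel :: real measure)"
      by (subst AE_iff_null_sets) auto
    then have "emeasure lborel {0<..<1::real} = 0"
      by (rule null_sets_subset[THEN null_setsD1]) auto
    then show False
      by simp
  qed
  moreover have "0 \<le> (LBINT t:{0<..}. F t)"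
    unfolding set_lebesgue_integral_def by (rule integral_nonneg_AE) (simp only: nonneg AE_I2)
  ultimately show ?thesis
    by simp
qed

text \<open>
  At \<open>z = -1\<close> the base of the complex power is a positive real number, so the principal power is
  the real one and the integral can be taken over the reals.
\<close>

lemma Phi_star_minus_one:
  "Phi_star v (-1) \<sigma> \<alpha> = complex_of_real (1 / Gamma \<sigma> *
    (LBINT t:{0<..}. t powr (\<sigma> - 1) * exp (- \<alpha> * t) / (1 + exp (- t)) powr v))"
proof -
  have "complex_of_real (t powr (\<sigma> - 1) * exp (- \<alpha> * t)) /
        (1 - (-1) * complex_of_real (exp (- t))) powr complex_of_real v =
      complex_of_real (t powr (\<sigma> - 1) * exp (- \<alpha> * t) / (1 + exp (- t)) powr v)" for t :: real
  proof -
    have "1 - (-1) * complex_of_real (exp (- t)) = complex_of_real (1 + exp (- t))"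
      by simp
    moreover have "complex_of_real (1 + exp (- t)) powr complex_of_real v =
        complex_of_real ((1 + exp (- t)) powr v)"
      by (rule powr_of_real) (simp add: add_nonneg_nonneg)
    ultimately show ?thesis
      by (simp only: of_real_divide)
  qed
  then show ?thesis
    unfolding Phi_star_def by (simp only: set_integral_complex_of_real of_real_mult)
qed

section \<open>The normalizing constant\<close>

text \<open>
  A finite, nonzero integral of the kernel is what makes the defining description of the
  constant have exactly one solution.
\<close>

lemma normalizing_const_eq:
  fixes \<mu> :: "real^'n"
  assumes "(\<integral>\<^sup>+x. ennreal (elliptical_kernel \<mu> \<Sigma> g x) \<partial>lborel) = ennreal I" "I > 0"
    and "elliptical_kernel \<mu> \<Sigma> g \<in> borel_measurable borel" "\<And>x. 0 \<le> elliptical_kernel \<mu> \<Sigma> g x"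
  shows "normalizing_const \<mu> \<Sigma> g = 1 / I"
  unfolding normalizing_const_def
proof (rule the_equality)
  have int: "has_bochner_integral lborel (elliptical_kernel \<mu> \<Sigma> g) I"
    using assms by (intro has_bochner_integral_nn_integral) auto
  from has_bochner_integral_mult_right[OF this, of "1 / I"]
  show "has_bochner_integral lborel (\<lambda>x. 1 / I * elliptical_kernel \<mu> \<Sigma> g x) 1"
    using \<open>I > 0\<close> by simp
  fix C
  assume "has_bochner_integral lborel (\<lambda>x. C * elliptical_kernel \<mu> \<Sigma> g x) 1"
  with has_bochner_integral_mult_right[OF int, of C] have "C * I = 1"
    by (metis has_bochner_integral_eq)
  then show "C = 1 / I"
    using \<open>I > 0\<close> by (simp add: field_simps)
qed

theorem theorem2p1:
  fixes N a b s r :: real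
    and \<mu> :: "real ^ 'n" and \<Sigma> :: "real ^ 'n ^ 'n"
    and M :: "'a measure" and X :: "'a \<Rightarrow> real ^ 'n"
  assumes "2 * N + real CARD('n) > 2"
    and "a > 0" and "b > 0" and "s > 0" and "r \<ge> 0"
    and "pos_def_matrix \<Sigma>"
    and "GL_distributed M X \<mu> \<Sigma> (gen_logistic N a b s r)"
  shows "complex_of_real (normalizing_const \<mu> \<Sigma> (gen_logistic N a b s r)) =
         complex_of_real (c_star CARD('n) N b s) *
         inverse (Phi_star (2 * r) (-1) (1 / s * (N + real CARD('n) / 2 - 1)) (a / b))"
proof -
  define \<sigma> where "\<sigma> = 1 / s * (N + real CARD('n) / 2 - 1)"
  define p where "p = CARD('n) / (2 * s)"
  define c where "c = pi powr (CARD('n) / 2) / (Gamma (CARD('n) / 2) * s) * b powr (- \<sigma>)"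
  define F where "F t = t powr (\<sigma> - 1) * exp (- (a / b) * t) / (1 + exp (- t)) powr (2 * r)" for t :: real
  define J where "J = (LBINT t:{0<..}. F t)"
  define G where "G y = (y / b) powr ((N - 1) / s) * exp (- (a / b) * y) / (1 + exp (- y)) powr (2 * r)"
    for y :: real
  let ?k = "elliptical_kernel \<mu> \<Sigma> (gen_logistic N a b s r)"
  have "\<sigma> > 0"
    using assms(1,4) by (simp add: \<sigma>_def)
  have det: "det \<Sigma> > 0"
    by (rule pos_def_det_pos[OF assms(6)])
  have "c > 0"
    using \<open>s > 0\<close> \<open>b > 0\<close> by (simp add: c_def Gamma_real_pos)
  have [measurable]: "G \<in> borel_measurable borel" "F \<in> borel_measurable borel"
    unfolding G_def F_def by measurable
  have intF: "set_integrable lborel {0<..} F"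
    unfolding F_def using \<open>\<sigma> > 0\<close> \<open>a > 0\<close> \<open>b > 0\<close> \<open>r \<ge> 0\<close> by (intro set_integrable_Phi_star_kernel) auto
  have Fpos: "0 < F t" if "0 < t" for t
  proof -
    have "1 + exp (- t) > 0"
      by (simp add: add_pos_pos)
    with that show ?thesis
      unfolding F_def by (intro divide_pos_pos mult_pos_pos) auto
  qed
  have J: "(\<integral>\<^sup>+t\<in>{0<..}. ennreal (F t) \<partial>lborel) = ennreal J"
  proof -
    have "(\<integral>\<^sup>+t\<in>{0<..}. ennreal (F t) \<partial>lborel) =
        (\<integral>\<^sup>+t. ennreal (indicator {0<..} t *\<^sub>R F t) \<partial>lborel)"
      by (intro nn_integral_cong) (simp add: indicator_def)
    also have "\<dots> = ennreal J"
      unfolding J_def set_lebesgue_integral_def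
      using intF Fpos by (intro nn_integral_eq_integral)
        (auto simp: set_integrable_def indicator_def less_imp_le)
    finally show ?thesis .
  qed
  have "J > 0"
    unfolding J_def using intF Fpos by (rule set_integral_halfline_pos)
  define Q where "Q x = (x - \<mu>) \<bullet> (matrix_inv \<Sigma> *v (x - \<mu>))" for x
  have [measurable]: "Q \<in> borel_measurable borel"
    unfolding Q_def by (rule borel_measurable_quadratic_form)
  \<comment> \<open>This also holds at \<open>x = \<mu>\<close>, where both sides are 0 since \<open>0 powr _ = 0\<close>.\<close>
  have kernel: "?k x = det \<Sigma> powr (- 1 / 2) * G (b * Q x powr s)" for x
    using \<open>b > 0\<close> \<open>s > 0\<close> by (simp add: elliptical_kernel_def gen_logistic_def G_def powr_powr Q_def)
  have G0: "0 \<le> G y" for y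
    by (simp add: G_def)
  have weight: "sqrt (det \<Sigma>) * pi powr (CARD('n) / 2) / (Gamma (CARD('n) / 2) * s) *
        b powr (- p) * y powr (p - 1) * G y = sqrt (det \<Sigma>) * c * F y" if "0 < y" for y
  proof -
    define q where "q = (N - 1) / s"
    have \<sigma>: "\<sigma> = p + q"
      using \<open>s > 0\<close> by (simp add: \<sigma>_def p_def q_def field_simps)
    have "(y / b) powr q = y powr q * b powr (- q)"
      using that \<open>b > 0\<close> by (simp add: powr_divide powr_minus_divide)
    moreover have "b powr (- \<sigma>) = b powr (- p) * b powr (- q)" "y powr (\<sigma> - 1) = y powr (p - 1) * y powr q"
      by (simp_all add: \<sigma> algebra_simps flip: powr_add)
    ultimately show ?thesis
      unfolding G_def F_def c_def q_def[symmetric] by simp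
  qed
  have "(\<integral>\<^sup>+x. ennreal (?k x) \<partial>lborel) =
      ennreal (det \<Sigma> powr (- 1 / 2)) * (\<integral>\<^sup>+x. ennreal (G (b * Q x powr s)) \<partial>lborel)"
    unfolding kernel by (simp add: ennreal_mult' G0 nn_integral_cmult)
  also have "(\<integral>\<^sup>+x. ennreal (G (b * Q x powr s)) \<partial>lborel) =
      (\<integral>\<^sup>+y\<in>{0<..}. ennreal (sqrt (det \<Sigma>) * pi powr (CARD('n) / 2) / (Gamma (CARD('n) / 2) * s) *
        b powr (- p) * y powr (p - 1)) * ennreal (G y) \<partial>lborel)"
    unfolding Q_def p_def by (rule nn_integral_elliptical) (use assms in simp_all)
  also have "\<dots> = (\<integral>\<^sup>+y. ennreal (sqrt (det \<Sigma>) * c) * (ennreal (F y) * indicator {0<..} y) \<partial>lborel)"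
  proof (rule nn_integral_cong)
    fix y :: real
    show "ennreal (sqrt (det \<Sigma>) * pi powr (CARD('n) / 2) / (Gamma (CARD('n) / 2) * s) *
        b powr (- p) * y powr (p - 1)) * ennreal (G y) * indicator {0<..} y =
        ennreal (sqrt (det \<Sigma>) * c) * (ennreal (F y) * indicator {0<..} y)"
    proof (cases "0 < y")
      case True
      have "ennreal (sqrt (det \<Sigma>) * c) * ennreal (F y) = ennreal (sqrt (det \<Sigma>) * c * F y)"
        using Fpos[OF True] by (intro ennreal_mult''[symmetric]) simp
      then show ?thesis
        using True G0[of y] by (simp only: weight[OF True, symmetric] ennreal_mult'') (simp add: mult_ac)
    qed simp
  qed
  also have "\<dots> = ennreal (sqrt (det \<Sigma>) * c) * ennreal J"
    by (simp add: nn_integral_cmult J)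
  also have "ennreal (det \<Sigma> powr (- 1 / 2)) * \<dots> = ennreal (det \<Sigma> powr (- 1 / 2) * sqrt (det \<Sigma>) * c * J)"
    using det \<open>c > 0\<close> \<open>J > 0\<close> by (simp add: mult.assoc flip: ennreal_mult)
  also have "det \<Sigma> powr (- 1 / 2) * sqrt (det \<Sigma>) = 1"
    using det by (simp add: powr_minus powr_half_sqrt)
  finally have "(\<integral>\<^sup>+x. ennreal (?k x) \<partial>lborel) = ennreal (c * J)"
    by simp
  then have "normalizing_const \<mu> \<Sigma> (gen_logistic N a b s r) = 1 / (c * J)"
  proof (rule normalizing_const_eq)
    have "?k = (\<lambda>x. det \<Sigma> powr (- 1 / 2) * G (b * Q x powr s))"
      using kernel by (rule ext)
    then show "?k \<in> borel_measurable borel"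
      by simp
  qed (use \<open>c > 0\<close> \<open>J > 0\<close> G0 in \<open>simp_all add: kernel\<close>)
  also have "\<dots> = c_star CARD('n) N b s * inverse (1 / Gamma \<sigma> * J)"
    using \<open>b > 0\<close> \<open>s > 0\<close> Gamma_real_pos[OF \<open>\<sigma> > 0\<close>]
    unfolding c_star_def c_def \<sigma>_def[symmetric] by (simp add: powr_minus field_simps)
  finally show ?thesis
    unfolding Phi_star_minus_one \<sigma>_def[symmetric] J_def F_def by simp
qed

end
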